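(* Call a CI-structure on a finite set $E$ any subset $\mathcal{G}\subseteq\mathcal{A}_E=\{(ij|K):K\subseteq E,\ i\neq j\in E\setminus K\}$, and call $\mathcal{G}$ a matroid if it satisfies (MCI) and (SG) below (equivalently, $\mathcal{G}=[[M]]$ for a loopless matroid $M$ on $E$). There is no finite set $\mathcal{F}$ of CI-structures such that, for every finite set $E$ and every CI-structure $\mathcal{G}$ on $E$, $\mathcal{G}$ is a matroid if and only if no minor of $\mathcal{G}$ is isomorphic to a member of $\mathcal{F}$. Here (MCI): for pairwise distinct $i,j,\ell\in E$ and disjoint $K,L\subseteq E\setminus\{i,j,\ell\}$, $(ij|K)\notin\mathcal{G}$ implies $(i\ell|jKL)\in\mathcal{G}$; (SG): for pairwise distinct $i,j,\ell$ and $K\subseteq E\setminus\{i,j,\ell\}$, $(ij|K),(i\ell|jK)\in\mathcal{G}$ imply $(i\ell|K),(ij|\ell K)\in\mathcal{G}$.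
   Context: $(ij|K)$ and $(ji|K)$ denote the same element; concatenation denotes disjoint union (e.g. $jKL=\{j\}\cup K\cup L$). For a loopless matroid $M$ on $E$ with rank $r$, $[[M]]=\{(ij|K)\in\mathcal{A}_E: r(iK)+r(jK)=r(ijK)+r(K)\}$. For $A\subseteq E$, the deletion is $\mathcal{G}\setminus A=\{(ij|K)\in\mathcal{G}: ijK\subseteq E\setminus A\}$ (a CI-structure on $E\setminus A$) and the contraction is $\mathcal{G}/A=\{(ij|K)\in\mathcal{A}_{E\setminus A}: (ij|K\cup A)\in\mathcal{G}\}$. A minor of $\mathcal{G}$ is any CI-structure obtained from $\mathcal{G}$ by a (possibly empty) sequence of deletions and contractions. Two CI-structures are isomorphic if one is obtained from the other by a bijective relabeling of the ground sets. *)

theory Defs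
  imports Main "HOL-Library.Infinite_Typeclass"
begin

text \<open>
  The element $(ij|K)$ is encoded as the pair of sets $(\{i,j\},K)$, so that $(ij|K) = (ji|K)$
  holds by construction. Since a set of such elements does not determine its ground set, the
  ground set is carried along explicitly: a CI-structure is given by \<open>E\<close> together with \<open>G\<close>.
\<close>

type_synonym 'a ci = "'a set \<times> 'a set"

definition ci :: "'a \<Rightarrow> 'a \<Rightarrow> 'a set \<Rightarrow> 'a ci"
  where "ci i j K = ({i, j}, K)"

definition all_ci :: "'a set \<Rightarrow> 'a ci set"
  where "all_ci E = {ci i j K | i j K. K \<subseteq> E \<and> i \<in> E - K \<and> j \<in> E - K \<and> i \<noteq> j}"

definition ci_structure :: "'a set \<Rightarrow> 'a ci set \<Rightarrow> bool"
  where "ci_structure E G \<longleftrightarrow> finite E \<and> G \<subseteq> all_ci E"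

definition MCI :: "'a set \<Rightarrow> 'a ci set \<Rightarrow> bool"
  where "MCI E G \<longleftrightarrow>
    (\<forall>i\<in>E. \<forall>j\<in>E. \<forall>l\<in>E. \<forall>K L.
       i \<noteq> j \<longrightarrow> i \<noteq> l \<longrightarrow> j \<noteq> l \<longrightarrow>
       K \<subseteq> E - {i, j, l} \<longrightarrow> L \<subseteq> E - {i, j, l} \<longrightarrow> K \<inter> L = {} \<longrightarrow>
       ci i j K \<notin> G \<longrightarrow> ci i l ({j} \<union> K \<union> L) \<in> G)"

definition SG :: "'a set \<Rightarrow> 'a ci set \<Rightarrow> bool"
  where "SG E G \<longleftrightarrow>
    (\<forall>i\<in>E. \<forall>j\<in>E. \<forall>l\<in>E. \<forall>K.
       i \<noteq> j \<longrightarrow> i \<noteq> l \<longrightarrow> j \<noteq> l \<longrightarrow> K \<subseteq> E - {i, j, l} \<longrightarrow>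
       ci i j K \<in> G \<longrightarrow> ci i l ({j} \<union> K) \<in> G \<longrightarrow>
       ci i l K \<in> G \<and> ci i j ({l} \<union> K) \<in> G)"

definition ci_matroid :: "'a set \<Rightarrow> 'a ci set \<Rightarrow> bool"
  where "ci_matroid E G \<longleftrightarrow> ci_structure E G \<and> MCI E G \<and> SG E G"

text \<open>Deletion and contraction of \<open>A\<close>; the new ground set is \<open>E - A\<close> in both cases.\<close>

definition deletion :: "'a set \<Rightarrow> 'a ci set \<Rightarrow> 'a set \<Rightarrow> 'a ci set"
  where "deletion E G A = {ci i j K | i j K. ci i j K \<in> G \<and> {i, j} \<union> K \<subseteq> E - A}"

definition contraction :: "'a set \<Rightarrow> 'a ci set \<Rightarrow> 'a set \<Rightarrow> 'a ci set"
  where "contraction E G A = {ci i j K | i j K. ci i j K \<in> all_ci (E - A) \<and> ci i j (K \<union> A) \<in> G}"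

inductive ci_minor :: "'a set \<Rightarrow> 'a ci set \<Rightarrow> 'a set \<Rightarrow> 'a ci set \<Rightarrow> bool"
  for E G where
  refl: "ci_minor E G E G"
| delete: "ci_minor E G E' G' \<Longrightarrow> A \<subseteq> E' \<Longrightarrow> ci_minor E G (E' - A) (deletion E' G' A)"
| contract: "ci_minor E G E' G' \<Longrightarrow> A \<subseteq> E' \<Longrightarrow> ci_minor E G (E' - A) (contraction E' G' A)"

definition relabel :: "('a \<Rightarrow> 'b) \<Rightarrow> 'a ci \<Rightarrow> 'b ci"
  where "relabel f = map_prod ((`) f) ((`) f)"

definition ci_iso :: "'a set \<Rightarrow> 'a ci set \<Rightarrow> 'b set \<Rightarrow> 'b ci set \<Rightarrow> bool"
  where "ci_iso E G E' G' \<longleftrightarrow> (\<exists>f. bij_betw f E E' \<and> relabel f ` G = G')"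

definition has_minor_in :: "'a set \<Rightarrow> 'a ci set \<Rightarrow> ('b set \<times> 'b ci set) set \<Rightarrow> bool"
  where "has_minor_in E G F \<longleftrightarrow>
    (\<exists>E' G'. ci_minor E G E' G' \<and> (\<exists>(H, S)\<in>F. ci_iso E' G' H S))"

lemma ci_structure_minor:
  assumes "ci_minor E G E' G'" and "ci_structure E G"
  shows "ci_structure E' G'"
  using assms
proof (induction rule: ci_minor.induct)
  case refl
  then show ?case .
next
  case (delete E' G' A)
  then show ?case
    by (fastforce simp: ci_structure_def deletion_def all_ci_def ci_def doubleton_eq_iff)
next
  case (contract E' G' A)
  then show ?case
    by (auto simp: ci_structure_def contraction_def)
qed

end

theory Submission imports Defs begin

text \<open>
  On a ground set $E$ with at least three elements, let $\mathcal{G}$ omit exactly the elements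
  $(ij|\emptyset)$ and $(ij|E \setminus ij)$. It violates (MCI) with $K = \emptyset$ and
  $L = E \setminus ij\ell$. Deleting a nonempty set destroys all the omissions of the second kind
  and leaves the uniform matroid of rank $1$; contracting a nonempty set destroys all those of the
  first kind and leaves a single circuit. So every proper minor of $\mathcal{G}$ is a matroid, and
  since $|E|$ is arbitrary there are excluded minors of every size.
\<close>

section \<open>Membership and extensionality for CI-structures\<close>

lemma ci_in_all_ci:
  "ci i j K \<in> all_ci E \<longleftrightarrow> K \<subseteq> E \<and> i \<in> E - K \<and> j \<in> E - K \<and> i \<noteq> j"
  unfolding all_ci_def ci_def by (auto simp: doubleton_eq_iff)

text \<open>The defining comprehension allows any representation of the element. The only ambiguity
  is swapping \<open>i\<close> and \<open>j\<close>, and the condition is symmetric in them, so it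
  may be tested on the given representation.\<close>

lemma ci_in_deletion:
  "ci i j K \<in> deletion E G A \<longleftrightarrow> ci i j K \<in> G \<and> {i, j} \<union> K \<subseteq> E - A"
  unfolding deletion_def ci_def by (auto simp: doubleton_eq_iff insert_commute)

lemma ci_in_contraction:
  "ci i j K \<in> contraction E G A \<longleftrightarrow> ci i j K \<in> all_ci (E - A) \<and> ci i j (K \<union> A) \<in> G"
  unfolding contraction_def ci_def by (auto simp: doubleton_eq_iff insert_commute)

lemma all_ciE:
  assumes "x \<in> all_ci E"
  obtains i j K where "x = ci i j K"
  using assms unfolding all_ci_def by blast

lemma deletion_subset: "deletion E G A \<subseteq> G"
  unfolding deletion_def by blast

lemma contraction_subset: "contraction E G A \<subseteq> all_ci (E - A)"
  unfolding contraction_def by blast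

lemma all_ci_eqI:
  assumes "G \<subseteq> all_ci E" "H \<subseteq> all_ci E"
    and "\<And>i j K. ci i j K \<in> G \<longleftrightarrow> ci i j K \<in> H"
  shows "G = H"
  using assms by (metis all_ciE subset_antisym subset_iff)

text \<open>Minor sequences may contain steps with an empty set; these must be seen not to leave the
  original structure.\<close>

lemma deletion_empty:
  assumes "G \<subseteq> all_ci E"
  shows "deletion E G {} = G"
proof (rule all_ci_eqI[where E = E])
  show "deletion E G {} \<subseteq> all_ci E"
    using deletion_subset assms by blast
  show "ci i j K \<in> deletion E G {} \<longleftrightarrow> ci i j K \<in> G" for i j K
    using assms ci_in_all_ci[of i j K E] by (auto simp: ci_in_deletion)
qed (fact assms)

lemma contraction_empty:
  assumes "G \<subseteq> all_ci E"
  shows "contraction E G {} = G"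
proof (rule all_ci_eqI[where E = E])
  show "contraction E G {} \<subseteq> all_ci E"
    using contraction_subset[of E G "{}"] by simp
  show "ci i j K \<in> contraction E G {} \<longleftrightarrow> ci i j K \<in> G" for i j K
    using assms by (auto simp: ci_in_contraction)
qed (fact assms)

section \<open>Closure of matroids under minors\<close>

lemma ci_matroid_deletion:
  assumes "ci_matroid E G" "A \<subseteq> E"
  shows "ci_matroid (E - A) (deletion E G A)"
  unfolding ci_matroid_def
proof (intro conjI)
  have str: "ci_structure E G" and mci: "MCI E G" and sg: "SG E G"
    using assms by (auto simp: ci_matroid_def)
  show "ci_structure (E - A) (deletion E G A)"
    using str assms(2) ci_structure_minor ci_minor.delete[OF ci_minor.refl] by blast
  show "MCI (E - A) (deletion E G A)"
    unfolding MCI_def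
  proof (intro ballI allI impI)
    fix i j l K L
    assume *: "i \<in> E - A" "j \<in> E - A" "l \<in> E - A" "i \<noteq> j" "i \<noteq> l" "j \<noteq> l"
      "K \<subseteq> E - A - {i, j, l}" "L \<subseteq> E - A - {i, j, l}" "K \<inter> L = {}"
      "ci i j K \<notin> deletion E G A"
    \<comment> \<open>Since \<open>i\<close>, \<open>j\<close> and \<open>K\<close> avoid
      \<open>A\<close>, absence from the deletion can only come from absence from
      \<open>G\<close>.\<close>
    then have "ci i j K \<notin> G"
      by (auto simp: ci_in_deletion)
    moreover have "K \<subseteq> E - {i, j, l}" "L \<subseteq> E - {i, j, l}"
      using * by auto
    ultimately have "ci i l ({j} \<union> K \<union> L) \<in> G"
      using mci * unfolding MCI_def by blast
    then show "ci i l ({j} \<union> K \<union> L) \<in> deletion E G A"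
      using * by (auto simp: ci_in_deletion)
  qed
  show "SG (E - A) (deletion E G A)"
    unfolding SG_def
  proof (intro ballI allI impI)
    fix i j l K
    assume *: "i \<in> E - A" "j \<in> E - A" "l \<in> E - A" "i \<noteq> j" "i \<noteq> l" "j \<noteq> l"
      "K \<subseteq> E - A - {i, j, l}" "ci i j K \<in> deletion E G A"
      "ci i l ({j} \<union> K) \<in> deletion E G A"
    then have "ci i j K \<in> G" "ci i l ({j} \<union> K) \<in> G"
      using deletion_subset by blast+
    moreover have "K \<subseteq> E - {i, j, l}"
      using * by auto
    ultimately have "ci i l K \<in> G \<and> ci i j ({l} \<union> K) \<in> G"
      using sg * unfolding SG_def by blast
    then show "ci i l K \<in> deletion E G A \<and> ci i j ({l} \<union> K) \<in> deletion E G A"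
      using * by (auto simp: ci_in_deletion)
  qed
qed

text \<open>Every instance of an axiom on \<open>E - A\<close> is an instance on \<open>E\<close>
  with \<open>A\<close> added to the conditioning set. In (MCI) the set \<open>A\<close> is joined
  to \<open>K\<close> and not to \<open>L\<close>, because the premise already conditions on
  it.\<close>

lemma ci_matroid_contraction:
  assumes "ci_matroid E G" "A \<subseteq> E"
  shows "ci_matroid (E - A) (contraction E G A)"
  unfolding ci_matroid_def
proof (intro conjI)
  have str: "ci_structure E G" and mci: "MCI E G" and sg: "SG E G"
    using assms by (auto simp: ci_matroid_def)
  show "ci_structure (E - A) (contraction E G A)"
    using str assms(2) ci_structure_minor ci_minor.contract[OF ci_minor.refl] by blast
  show "MCI (E - A) (contraction E G A)"
    unfolding MCI_def
  proof (intro ballI allI impI)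
    fix i j l K L
    assume *: "i \<in> E - A" "j \<in> E - A" "l \<in> E - A" "i \<noteq> j" "i \<noteq> l" "j \<noteq> l"
      "K \<subseteq> E - A - {i, j, l}" "L \<subseteq> E - A - {i, j, l}" "K \<inter> L = {}"
      "ci i j K \<notin> contraction E G A"
    then have "ci i j (K \<union> A) \<notin> G"
      by (auto simp: ci_in_contraction ci_in_all_ci)
    moreover have "K \<union> A \<subseteq> E - {i, j, l}" "L \<subseteq> E - {i, j, l}" "(K \<union> A) \<inter> L = {}"
      using * assms(2) by auto
    ultimately have "ci i l ({j} \<union> (K \<union> A) \<union> L) \<in> G"
      using mci * unfolding MCI_def by blast
    then have "ci i l ({j} \<union> K \<union> L \<union> A) \<in> G"
      by (simp add: Un_ac)
    then show "ci i l ({j} \<union> K \<union> L) \<in> contraction E G A"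
      using * by (auto simp: ci_in_contraction ci_in_all_ci)
  qed
  show "SG (E - A) (contraction E G A)"
    unfolding SG_def
  proof (intro ballI allI impI)
    fix i j l K
    assume *: "i \<in> E - A" "j \<in> E - A" "l \<in> E - A" "i \<noteq> j" "i \<noteq> l" "j \<noteq> l"
      "K \<subseteq> E - A - {i, j, l}" "ci i j K \<in> contraction E G A"
      "ci i l ({j} \<union> K) \<in> contraction E G A"
    then have "ci i j (K \<union> A) \<in> G" "ci i l ({j} \<union> (K \<union> A)) \<in> G"
      by (auto simp: ci_in_contraction)
    moreover have "K \<union> A \<subseteq> E - {i, j, l}"
      using * assms(2) by auto
    ultimately have "ci i l (K \<union> A) \<in> G \<and> ci i j ({l} \<union> (K \<union> A)) \<in> G"
      using sg * unfolding SG_def by blast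
    then show "ci i l K \<in> contraction E G A \<and> ci i j ({l} \<union> K) \<in> contraction E G A"
      using * by (auto simp: ci_in_contraction ci_in_all_ci)
  qed
qed

section \<open>The uniform matroid of rank one and the single circuit\<close>

definition rank_one_ci :: "'a set \<Rightarrow> 'a ci set"
  where "rank_one_ci E = {x \<in> all_ci E. snd x \<noteq> {}}"

text \<open>When \<open>E\<close> is a circuit, its proper subsets are independent, so the rank
  equality fails only where \<open>i\<close>, \<open>j\<close> and \<open>K\<close> exhaust
  \<open>E\<close>.\<close>

definition circuit_ci :: "'a set \<Rightarrow> 'a ci set"
  where "circuit_ci E = {x \<in> all_ci E. fst x \<union> snd x \<noteq> E}"

lemma ci_in_rank_one_ci: "ci i j K \<in> rank_one_ci E \<longleftrightarrow> ci i j K \<in> all_ci E \<and> K \<noteq> {}"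
  by (simp add: rank_one_ci_def ci_def)

lemma ci_in_circuit_ci:
  "ci i j K \<in> circuit_ci E \<longleftrightarrow> ci i j K \<in> all_ci E \<and> {i, j} \<union> K \<noteq> E"
  by (simp add: circuit_ci_def ci_def)

text \<open>The conclusion of (MCI) conditions on \<open>j\<close>, hence on a nonempty set. In (SG)
  the first premise makes \<open>K\<close> nonempty, and both conclusions condition on a superset of
  \<open>K\<close>.\<close>

lemma ci_matroid_rank_one_ci:
  assumes "finite E"
  shows "ci_matroid E (rank_one_ci E)"
  unfolding ci_matroid_def
proof (intro conjI)
  show "ci_structure E (rank_one_ci E)"
    using assms by (auto simp: ci_structure_def rank_one_ci_def)
  show "MCI E (rank_one_ci E)" "SG E (rank_one_ci E)"
    unfolding MCI_def SG_def ci_in_rank_one_ci ci_in_all_ci by blast+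
qed

text \<open>(MCI) holds vacuously: its premise would need \<open>i\<close>, \<open>j\<close> and
  \<open>K\<close> to exhaust \<open>E\<close>, but \<open>l\<close> is left over. In (SG) the
  second premise says that \<open>i\<close>, \<open>j\<close>, \<open>l\<close> and \<open>K\<close>
  do not exhaust \<open>E\<close>, so neither conclusion does.\<close>

lemma ci_matroid_circuit_ci:
  assumes "finite E"
  shows "ci_matroid E (circuit_ci E)"
  unfolding ci_matroid_def
proof (intro conjI)
  show "ci_structure E (circuit_ci E)"
    using assms by (auto simp: ci_structure_def circuit_ci_def)
  show "MCI E (circuit_ci E)"
    unfolding MCI_def
  proof (intro ballI allI impI)
    fix i j l K L
    assume "i \<in> E" "j \<in> E" "l \<in> E" "i \<noteq> j" "i \<noteq> l" "j \<noteq> l"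
      "K \<subseteq> E - {i, j, l}" "ci i j K \<notin> circuit_ci E"
    moreover from this have "l \<notin> {i, j} \<union> K"
      by blast
    ultimately have False
      by (auto simp: ci_in_circuit_ci ci_in_all_ci)
    then show "ci i l ({j} \<union> K \<union> L) \<in> circuit_ci E" ..
  qed
  show "SG E (circuit_ci E)"
    unfolding SG_def ci_in_circuit_ci ci_in_all_ci by blast
qed

section \<open>The excluded minor and its proper minors\<close>

lemma deletion_rank_one_Int_circuit:
  assumes "A \<subseteq> E" "A \<noteq> {}"
  shows "deletion E (rank_one_ci E \<inter> circuit_ci E) A = rank_one_ci (E - A)"
proof (rule all_ci_eqI[where E = "E - A"])
  show "rank_one_ci (E - A) \<subseteq> all_ci (E - A)"
    by (auto simp: rank_one_ci_def)
  show "deletion E (rank_one_ci E \<inter> circuit_ci E) A \<subseteq> all_ci (E - A)"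
    by (auto simp: deletion_def rank_one_ci_def ci_in_all_ci)
  show "ci i j K \<in> deletion E (rank_one_ci E \<inter> circuit_ci E) A
      \<longleftrightarrow> ci i j K \<in> rank_one_ci (E - A)" for i j K
    \<comment> \<open>An element avoiding the nonempty set \<open>A\<close> cannot exhaust
      \<open>E\<close>, so only the condition \<open>K \<noteq> {}\<close> survives.\<close>
    using assms
    by (auto simp: ci_in_deletion ci_in_rank_one_ci ci_in_circuit_ci ci_in_all_ci)
qed

lemma contraction_rank_one_Int_circuit:
  assumes "A \<subseteq> E" "A \<noteq> {}"
  shows "contraction E (rank_one_ci E \<inter> circuit_ci E) A = circuit_ci (E - A)"
proof (rule all_ci_eqI[where E = "E - A"])
  show "contraction E (rank_one_ci E \<inter> circuit_ci E) A \<subseteq> all_ci (E - A)"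
    by (rule contraction_subset)
  show "circuit_ci (E - A) \<subseteq> all_ci (E - A)"
    by (auto simp: circuit_ci_def)
  show "ci i j K \<in> contraction E (rank_one_ci E \<inter> circuit_ci E) A
      \<longleftrightarrow> ci i j K \<in> circuit_ci (E - A)" for i j K
    \<comment> \<open>Here \<open>K \<union> A\<close> is never empty, and adding \<open>A\<close>
      exhausts \<open>E\<close> exactly when \<open>i\<close>, \<open>j\<close> and \<open>K\<close>
      exhaust \<open>E - A\<close>.\<close>
    using assms
    by (auto simp: ci_in_contraction ci_in_rank_one_ci ci_in_circuit_ci ci_in_all_ci)
qed

lemma ci_structure_rank_one_Int_circuit:
  "finite E \<Longrightarrow> ci_structure E (rank_one_ci E \<inter> circuit_ci E)"
  by (auto simp: ci_structure_def rank_one_ci_def)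

lemma not_ci_matroid_rank_one_Int_circuit:
  assumes "card E \<ge> 3"
  shows "\<not> ci_matroid E (rank_one_ci E \<inter> circuit_ci E)"
proof
  assume "ci_matroid E (rank_one_ci E \<inter> circuit_ci E)"
  then have mci: "MCI E (rank_one_ci E \<inter> circuit_ci E)"
    by (simp add: ci_matroid_def)
  obtain T where "T \<subseteq> E" "card T = 3"
    using assms by (meson obtain_subset_with_card_n)
  then obtain i j l where ijl: "i \<in> E" "j \<in> E" "l \<in> E" "i \<noteq> j" "i \<noteq> l" "j \<noteq> l"
    by (auto simp: card_3_iff)
  have "ci i j {} \<notin> rank_one_ci E \<inter> circuit_ci E"
    by (simp add: ci_in_rank_one_ci)
  \<comment> \<open>The set \<open>L\<close> is chosen to fill up \<open>E\<close>, so that (MCI)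
    forces an element omitted by \<open>circuit_ci E\<close>.\<close>
  then have "ci i l ({j} \<union> {} \<union> (E - {i, j, l})) \<in> rank_one_ci E \<inter> circuit_ci E"
    using mci ijl unfolding MCI_def by blast
  then have "{i, l} \<union> ({j} \<union> {} \<union> (E - {i, j, l})) \<noteq> E"
    by (simp add: ci_in_circuit_ci)
  with ijl show False
    by blast
qed

text \<open>The disjunction is the invariant of the induction: steps with an empty set preserve the
  first alternative, the first nonempty step leads to the second, and closure under minors keeps it
  there.\<close>

lemma ci_minor_rank_one_Int_circuit:
  assumes "ci_minor E (rank_one_ci E \<inter> circuit_ci E) E' G'" "finite E"
  shows "(E' = E \<and> G' = rank_one_ci E \<inter> circuit_ci E) \<or> ci_matroid E' G'"
  using assms(1)
proof (induction rule: ci_minor.induct)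
  case refl
  then show ?case by simp
next
  case (delete E' G' A)
  then show ?case
    using assms(2) ci_matroid_deletion[of E' G' A] deletion_rank_one_Int_circuit[of A E]
      ci_matroid_rank_one_ci[of "E - A"] deletion_empty[of G' E]
      ci_structure_rank_one_Int_circuit[of E]
    by (cases "A = {}") (auto simp: ci_structure_def)
next
  case (contract E' G' A)
  then show ?case
    using assms(2) ci_matroid_contraction[of E' G' A] contraction_rank_one_Int_circuit[of A E]
      ci_matroid_circuit_ci[of "E - A"] contraction_empty[of G' E]
      ci_structure_rank_one_Int_circuit[of E]
    by (cases "A = {}") (auto simp: ci_structure_def)
qed

text \<open>The infinite type \<open>'a\<close> supplies an excluded minor larger than every member
  of \<open>F\<close>. A minor of it isomorphic to a member of \<open>F\<close> is proper, hence a
  matroid, although it contains a forbidden minor.\<close>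

theorem theorem2p4:
  "\<not> (\<exists>F :: ('b set \<times> 'b ci set) set.
        finite F \<and> (\<forall>(H, S)\<in>F. ci_structure H S) \<and>
        (\<forall>(E :: 'a::infinite set) G. ci_structure E G \<longrightarrow>
           (ci_matroid E G \<longleftrightarrow> \<not> has_minor_in E G F)))"
proof
  assume "\<exists>F :: ('b set \<times> 'b ci set) set.
        finite F \<and> (\<forall>(H, S)\<in>F. ci_structure H S) \<and>
        (\<forall>(E :: 'a set) G. ci_structure E G \<longrightarrow>
           (ci_matroid E G \<longleftrightarrow> \<not> has_minor_in E G F))"
  then obtain F :: "('b set \<times> 'b ci set) set" where "finite F"
    and char: "\<And>(E :: 'a set) G. ci_structure E G \<Longrightarrow>
      ci_matroid E G \<longleftrightarrow> \<not> has_minor_in E G F"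
    by blast
  \<comment> \<open>The inserted 2 covers an empty \<open>F\<close> and guarantees that a ground set
    of size \<open>Suc n\<close> has the three elements needed to violate (MCI).\<close>
  define n where "n = Max (insert 2 ((\<lambda>(H, S). card H) ` F))"
  have nF: "card H \<le> n" if "(H, S) \<in> F" for H S
    using \<open>finite F\<close> that unfolding n_def by (auto intro!: Max_ge)
  have "2 \<le> n"
    using \<open>finite F\<close> unfolding n_def by (auto intro!: Max_ge)
  obtain E :: "'a set" where E: "finite E" "card E = Suc n"
    using infinite_arbitrarily_large[OF infinite_UNIV] by blast
  define G where "G = rank_one_ci E \<inter> circuit_ci E"
  have "\<not> ci_matroid E G"
    using E \<open>2 \<le> n\<close> unfolding G_def by (intro not_ci_matroid_rank_one_Int_circuit) simp
  moreover have str: "ci_structure E G"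
    using E unfolding G_def by (intro ci_structure_rank_one_Int_circuit)
  ultimately have "has_minor_in E G F"
    using char by blast
  then obtain E' G' H S where minor: "ci_minor E G E' G'"
    and HS: "(H, S) \<in> F" and iso: "ci_iso E' G' H S"
    unfolding has_minor_in_def by blast
  have "card E' \<le> n"
    using nF[OF HS] iso bij_betw_same_card unfolding ci_iso_def by metis
  then have "E' \<noteq> E"
    using E by auto
  then have "ci_matroid E' G'"
    using ci_minor_rank_one_Int_circuit minor E unfolding G_def by blast
  \<comment> \<open>The structure is a minor of itself, and it is isomorphic to a member of
    \<open>F\<close>.\<close>
  moreover have "has_minor_in E' G' F"
    using ci_minor.refl HS iso unfolding has_minor_in_def by blast
  ultimately show False
    using char[OF ci_structure_minor[OF minor str]] by blast
qed

end
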